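(* Let $K_c>0$, $\eta_c>0$, $I_d\ge 0$ be real numbers, let $f_I(x)=\frac{1}{\sqrt{2\pi}}\exp\left(-\frac{(x-I_d)^2}{2}\right)$, and let $f_P$ be the density of the harvested solar power on $(0,\infty)$, i.e. $f_P(p)=\frac12\sqrt{\frac{K_c}{\eta_c p}}\,f_I\!\left(\sqrt{\frac{K_c p}{\eta_c}}\right)$ for $0<p<\eta_cK_c$ and $f_P(p)=\frac1{\eta_c}f_I\!\left(\frac{p}{\eta_c}\right)$ for $p\ge\eta_cK_c$. Put $\tau=1+\operatorname{erf}\left(\frac{I_d-K_c}{\sqrt2}\right)$ and $\nu=\tau-1-\operatorname{erf}\left(\frac{I_d}{\sqrt2}\right)$. Then the first moment $M_1=\mathbb E[P]=\int_0^\infty p f_P(p)\,dp$ equals $$M_1=\frac12\eta_cI_d\,\tau-\frac{I_d\,\eta_c\left(e^{-\frac{(I_d-K_c)^2}{2}}-e^{-\frac{I_d^2}{2}}\right)}{\sqrt{2\pi}\,K_c}-\frac12\,\frac{\eta_c}{K_c}(1+I_d^2)\,\nu.$$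
   Context: $\operatorname{erf}(x)=\frac{2}{\sqrt\pi}\int_0^x e^{-t^2}dt$. $f_P$ is the density on $(0,\infty)$ of the power $P$ harvested by a photovoltaic system with efficiency $\eta_c$ and threshold intensity $K_c$, where $P=\frac{\eta_c}{K_c}I^2$ for $0<I<K_c$ and $P=\eta_c I$ for $I\ge K_c$, with radiation intensity $I\sim N(I_d,1)$. *)

theory Defs
  imports "HOL-Probability.Probability"
begin

text \<open>The interval integral is oriented, so this is also the right function for negative arguments.\<close>

definition erf :: "real \<Rightarrow> real" where
  "erf x = 2 / sqrt pi * (LBINT t=0..x. exp (- t\<^sup>2))"

text \<open>
  The power harvested at radiation intensity \<open>x\<close>. A Gaussian intensity is
  nonpositive with positive probability; no power is harvested in that case.
\<close>

definition harvested_power :: "real \<Rightarrow> real \<Rightarrow> real \<Rightarrow> real" where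
  "harvested_power \<eta>\<^sub>c K\<^sub>c x =
    (if x \<le> 0 then 0
     else if x < K\<^sub>c then \<eta>\<^sub>c / K\<^sub>c * x\<^sup>2
     else \<eta>\<^sub>c * x)"

text \<open>
  The density of the harvested power on the positive half-line, for an intensity with
  distribution \<open>N(I\<^sub>d, 1)\<close>. It does not integrate to \<open>1\<close>: the remaining mass
  is the atom of the power at \<open>0\<close>. The value for \<open>p \<le> 0\<close> is irrelevant.
\<close>

definition power_density :: "real \<Rightarrow> real \<Rightarrow> real \<Rightarrow> real \<Rightarrow> real" where
  "power_density \<eta>\<^sub>c K\<^sub>c I\<^sub>d p =
    (if p \<le> 0 then 0
     else if p < \<eta>\<^sub>c * K\<^sub>c
       then 1 / 2 * sqrt (K\<^sub>c / (\<eta>\<^sub>c * p)) * normal_density I\<^sub>d 1 (sqrt (K\<^sub>c * p / \<eta>\<^sub>c))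
     else 1 / \<eta>\<^sub>c * normal_density I\<^sub>d 1 (p / \<eta>\<^sub>c))"

end

theory Submission
  imports Defs "HOL-Real_Asymp.Real_Asymp"
begin

text \<open>
  In terms of the intensity \<open>x\<close> the moment is
  \<open>\<eta>\<^sub>c / K\<^sub>c * \<integral>\<^bsub>0\<^esub>\<^bsup>K\<^sub>c\<^esup> x\<^sup>2 \<phi> x dx + \<eta>\<^sub>c * \<integral>\<^bsub>K\<^sub>c\<^esub>\<^bsup>\<infinity>\<^esup> x \<phi> x dx\<close>, where \<open>\<phi>\<close> is the Gaussian density.
  From \<open>\<phi>' x = - (x - I\<^sub>d) \<phi> x\<close> one finds explicit antiderivatives of \<open>x \<phi> x\<close> and \<open>x\<^sup>2 \<phi> x\<close> in
  terms of \<open>\<phi>\<close> and the distribution function; composed with \<open>\<lambda>p. p / \<eta>\<^sub>c\<close> and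
  \<open>\<lambda>p. sqrt (K\<^sub>c * p / \<eta>\<^sub>c)\<close> they are antiderivatives of the integrand on the power side.
  So both integrals come from the fundamental theorem of calculus for nonnegative functions,
  which also gives integrability.
\<close>

section \<open>The error function: derivative, parity and limit\<close>

lemma DERIV_erf: "(erf has_real_derivative 2 / sqrt pi * exp (- x\<^sup>2)) (at x)"
proof -
  define a b where "a = - \<bar>x\<bar> - 1" and "b = \<bar>x\<bar> + 1"
  have ord: "a < 0" "0 < b" "a < x" "x < b"
    by (auto simp: a_def b_def)
  have "((\<lambda>u. LBINT y=ereal 0..ereal u. exp (- y\<^sup>2)) has_vector_derivative exp (- x\<^sup>2)) (at x within {a..b})"
    using ord by (intro interval_integral_FTC2 continuous_intros) linarith+
  then have "((\<lambda>u. LBINT y=ereal 0..ereal u. exp (- y\<^sup>2)) has_vector_derivative exp (- x\<^sup>2)) (at x)"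
    using ord by (simp add: at_within_Icc_at)
  then have "((\<lambda>u. LBINT y=0..u. exp (- y\<^sup>2)) has_real_derivative exp (- x\<^sup>2)) (at x)"
    by (simp add: has_real_derivative_iff_has_vector_derivative zero_ereal_def)
  then show ?thesis
    unfolding erf_def[abs_def] by (rule DERIV_cmult)
qed

lemma erf_minus: "erf (- x) = - erf x"
  unfolding erf_def
  by (subst interval_integral_reflect) (simp add: interval_integral_endpoints_reverse[of 0])

lemma tendsto_erf_at_top: "(erf \<longlongrightarrow> 1) at_top"
proof -
  have int: "set_integrable lborel {0..} (\<lambda>t::real. exp (- t\<^sup>2))"
    and val: "(LBINT t:{0..}. exp (- t\<^sup>2)) = sqrt pi / 2"
    using gaussian_moment_0
    by (auto simp: set_integrable_def set_lebesgue_integral_def has_bochner_integral_iff)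
  have "((\<lambda>x. LBINT t:{0..x}. exp (- t\<^sup>2)) \<longlongrightarrow> sqrt pi / 2) at_top"
    using tendsto_set_lebesgue_integral_at_top[OF _ int] val by simp
  \<comment> \<open>The oriented integral and the set integral over \<open>{0..x}\<close> are
    compared only for \<open>x \<ge> 0\<close>, which suffices at infinity.\<close>
  moreover have "\<forall>\<^sub>F x in at_top. (LBINT t:{0..x}. exp (- t\<^sup>2)) = (LBINT t=0..x. exp (- t\<^sup>2))"
    using eventually_ge_at_top[of "0::real"]
    by eventually_elim (simp add: zero_ereal_def interval_integral_Icc)
  ultimately have "((\<lambda>x. LBINT t=0..ereal x. exp (- t\<^sup>2)) \<longlongrightarrow> sqrt pi / 2) at_top"
    by (rule Lim_transform_eventually)
  then have "((\<lambda>x. 2 / sqrt pi * (LBINT t=0..ereal x. exp (- t\<^sup>2))) \<longlongrightarrow> 2 / sqrt pi * (sqrt pi / 2)) at_top"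
    by (rule tendsto_mult_left)
  then show ?thesis
    by (simp add: erf_def[abs_def])
qed

section \<open>Gaussian moment antiderivatives and their evaluation on two pieces\<close>

lemma DERIV_normal_density:
  "(normal_density \<mu> 1 has_real_derivative - (x - \<mu>) * normal_density \<mu> 1 x) (at x)"
proof -
  have "((\<lambda>x. exp (- (x - \<mu>)\<^sup>2 / 2)) has_real_derivative - (x - \<mu>) * exp (- (x - \<mu>)\<^sup>2 / 2)) (at x)"
    by (auto intro!: derivative_eq_intros simp: field_simps)
  from DERIV_cmult[OF this, of "1 / sqrt (2 * pi)"] show ?thesis
    by (simp add: normal_density_def[abs_def] mult.left_commute)
qed

lemma tendsto_normal_density_at_top: "(normal_density \<mu> 1 \<longlongrightarrow> 0) at_top"
  unfolding normal_density_def[abs_def] by real_asymp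

text \<open>The distribution function of \<open>N(\<mu>, 1)\<close> is obtained by adding \<open>1 / 2\<close>.\<close>

definition centred_normal_cdf :: "real \<Rightarrow> real \<Rightarrow> real" where
  "centred_normal_cdf \<mu> x = - erf ((\<mu> - x) / sqrt 2) / 2"

lemma DERIV_centred_normal_cdf:
  "(centred_normal_cdf \<mu> has_real_derivative normal_density \<mu> 1 x) (at x)"
proof -
  have "((\<lambda>x. erf ((\<mu> - x) / sqrt 2)) has_real_derivative
      2 / sqrt pi * exp (- ((\<mu> - x) / sqrt 2)\<^sup>2) * (- 1 / sqrt 2)) (at x)"
    by (rule DERIV_chain2[OF DERIV_erf]) (auto intro!: derivative_eq_intros simp: real_div_sqrt)
  \<comment> \<open>The constants combine to \<open>1 / sqrt (2 * pi)\<close>, and the squared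
    argument is half of \<open>(x - \<mu>)\<^sup>2\<close>.\<close>
  from DERIV_cmult[OF this, of "- 1 / 2"] show ?thesis
    unfolding centred_normal_cdf_def[abs_def]
    by (simp add: normal_density_def power_divide real_sqrt_mult power2_commute field_simps)
qed

lemma tendsto_centred_normal_cdf_at_top: "(centred_normal_cdf \<mu> \<longlongrightarrow> 1 / 2) at_top"
proof -
  have lim: "((\<lambda>x. erf ((x - \<mu>) / sqrt 2)) \<longlongrightarrow> 1) at_top"
    by (rule filterlim_compose[OF tendsto_erf_at_top]) real_asymp
  \<comment> \<open>Oddness turns the argument around, so that it tends to plus infinity, where the
    limit of \<open>erf\<close> is known.\<close>
  have "centred_normal_cdf \<mu> x = 1 / 2 * erf ((x - \<mu>) / sqrt 2)" for x
    using erf_minus[of "(\<mu> - x) / sqrt 2"] minus_divide_left[of "\<mu> - x" "sqrt 2"]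
    by (simp add: centred_normal_cdf_def)
  then have "centred_normal_cdf \<mu> = (\<lambda>x. 1 / 2 * erf ((x - \<mu>) / sqrt 2))"
    by (rule ext)
  then show ?thesis
    using tendsto_mult_left[OF lim, of "1 / 2"] by simp
qed

definition first_moment_prim :: "real \<Rightarrow> real \<Rightarrow> real" where
  "first_moment_prim \<mu> x = \<mu> * centred_normal_cdf \<mu> x - normal_density \<mu> 1 x"

text \<open>With phi the density, phi' = -(x - \<mu>) phi gives ((x + \<mu>) phi)' = phi - (x^2 -
  \<mu>^2) phi, hence x^2 phi = (1 + \<mu>^2) phi - ((x + \<mu>) phi)'.\<close>

definition second_moment_prim :: "real \<Rightarrow> real \<Rightarrow> real" where
  "second_moment_prim \<mu> x =
    (1 + \<mu>\<^sup>2) * centred_normal_cdf \<mu> x - (x + \<mu>) * normal_density \<mu> 1 x"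

lemma DERIV_first_moment_prim:
  "(first_moment_prim \<mu> has_real_derivative x * normal_density \<mu> 1 x) (at x)"
  unfolding first_moment_prim_def[abs_def]
  by (auto intro!: derivative_eq_intros DERIV_centred_normal_cdf DERIV_normal_density
      simp: algebra_simps)

lemma DERIV_second_moment_prim:
  "(second_moment_prim \<mu> has_real_derivative x\<^sup>2 * normal_density \<mu> 1 x) (at x)"
  unfolding second_moment_prim_def[abs_def]
  by (auto intro!: derivative_eq_intros DERIV_centred_normal_cdf DERIV_normal_density
      simp: algebra_simps power2_eq_square)

lemma tendsto_first_moment_prim_at_top: "(first_moment_prim \<mu> \<longlongrightarrow> \<mu> / 2) at_top"
  unfolding first_moment_prim_def[abs_def]
  by (auto intro!: tendsto_eq_intros tendsto_centred_normal_cdf_at_top tendsto_normal_density_at_top)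

text \<open>Nonnegativity makes finite limits of the antiderivatives at the endpoints enough for
  integrability, also on the unbounded piece. Derivatives are asked for only on the open pieces: on
  the power side the square root has no derivative at 0, and continuity of \<open>F\<^sub>1\<close>
  has to do there.\<close>

lemma set_integral_FTC_nonneg_two_pieces:
  fixes f f\<^sub>1 f\<^sub>2 F\<^sub>1 F\<^sub>2 :: "real \<Rightarrow> real"
  assumes "a < c"
    and f1: "\<And>x. a < x \<Longrightarrow> x < c \<Longrightarrow> f x = f\<^sub>1 x" and f2: "\<And>x. c < x \<Longrightarrow> f x = f\<^sub>2 x"
    and "\<And>x. a < x \<Longrightarrow> x < c \<Longrightarrow> (F\<^sub>1 has_real_derivative f\<^sub>1 x) (at x)"
    and "\<And>x. c < x \<Longrightarrow> (F\<^sub>2 has_real_derivative f\<^sub>2 x) (at x)"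
    and "\<And>x. a < x \<Longrightarrow> x < c \<Longrightarrow> isCont f\<^sub>1 x" and "\<And>x. c < x \<Longrightarrow> isCont f\<^sub>2 x"
    and "\<And>x. a < x \<Longrightarrow> x < c \<Longrightarrow> 0 \<le> f\<^sub>1 x" and "\<And>x. c < x \<Longrightarrow> 0 \<le> f\<^sub>2 x"
    and "isCont F\<^sub>1 a" and "isCont F\<^sub>1 c" and "isCont F\<^sub>2 c" and "(F\<^sub>2 \<longlongrightarrow> L) at_top"
  shows "set_integrable lborel {a<..} f"
    and "(LBINT x:{a<..}. f x) = F\<^sub>1 c - F\<^sub>1 a + (L - F\<^sub>2 c)"
proof -
  \<comment> \<open>The fundamental theorem is stated for extended real endpoints and asks for
    one-sided limits there; at finite endpoints continuity supplies them.\<close>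
  have lim: "((F \<circ> real_of_ereal) \<longlongrightarrow> F x) (at_right (ereal x))"
    "((F \<circ> real_of_ereal) \<longlongrightarrow> F x) (at_left (ereal x))"
    if "isCont F x" for F :: "real \<Rightarrow> real" and x
    using that
    by (auto simp: ereal_tendsto_simps isCont_def intro: filterlim_mono at_le)
  have 1: "set_integrable lborel (einterval (ereal a) (ereal c)) f\<^sub>1"
    "(LBINT x=ereal a..ereal c. f\<^sub>1 x) = F\<^sub>1 c - F\<^sub>1 a"
    by (rule interval_integral_FTC_nonneg[of _ _ F\<^sub>1]; use assms lim in force)+
  have 2: "set_integrable lborel (einterval (ereal c) \<infinity>) f\<^sub>2"
    "(LBINT x=ereal c..\<infinity>. f\<^sub>2 x) = L - F\<^sub>2 c"
    by (rule interval_integral_FTC_nonneg[of _ _ F\<^sub>2];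
        use assms lim in \<open>force simp: ereal_tendsto_simps\<close>)+
  have i1: "set_integrable lborel {a<..<c} f"
    using 1(1) f1 by (subst set_integrable_cong[OF refl refl, of _ _ f\<^sub>1]) auto
  have i2: "set_integrable lborel {c<..} f"
    using 2(1) f2 by (subst set_integrable_cong[OF refl refl, of _ _ f\<^sub>2]) auto
  have "(LBINT x:{a<..<c}. f x) = (LBINT x:{a<..<c}. f\<^sub>1 x)"
    using f1 by (intro set_lebesgue_integral_cong) auto
  then have v1: "(LBINT x:{a<..<c}. f x) = F\<^sub>1 c - F\<^sub>1 a"
    using 1(2) \<open>a < c\<close> by (simp add: interval_integral_Ioo)
  have "(LBINT x:{c<..}. f x) = (LBINT x:{c<..}. f\<^sub>2 x)"
    using f2 by (intro set_lebesgue_integral_cong) auto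
  then have v2: "(LBINT x:{c<..}. f x) = L - F\<^sub>2 c"
    using 2(2) by (simp add: interval_integral_to_infinity_eq)
  \<comment> \<open>Only the break point is lost in the splitting, and it is a null set.\<close>
  have diff: "({a<..} - ({a<..<c} \<union> {c<..})) \<union> (({a<..<c} \<union> {c<..}) - {a<..}) \<subseteq> {c}"
    using \<open>a < c\<close> by auto
  have "set_integrable lborel ({a<..<c} \<union> {c<..}) f"
    using i1 i2 by (rule set_integrable_Un) auto
  then show "set_integrable lborel {a<..} f"
    using set_integrable_discrete_difference[OF _ diff, of lborel f] by simp
  have "(LBINT x:{a<..}. f x) = (LBINT x:{a<..<c} \<union> {c<..}. f x)"
    by (rule set_integral_discrete_difference[OF _ diff]) auto
  also have "\<dots> = F\<^sub>1 c - F\<^sub>1 a + (L - F\<^sub>2 c)"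
    using i1 i2 v1 v2 by (subst set_integral_Un) auto
  finally show "(LBINT x:{a<..}. f x) = F\<^sub>1 c - F\<^sub>1 a + (L - F\<^sub>2 c)" .
qed

section \<open>The first moment in the intensity and in the power variable\<close>

lemma isCont_normal_density: "isCont (normal_density \<mu> 1) x"
  by (rule DERIV_isCont[OF DERIV_normal_density])

lemma isCont_first_moment_prim: "isCont (first_moment_prim \<mu>) x"
  by (rule DERIV_isCont[OF DERIV_first_moment_prim])

lemma isCont_second_moment_prim: "isCont (second_moment_prim \<mu>) x"
  by (rule DERIV_isCont[OF DERIV_second_moment_prim])

text \<open>This value is the expectation of the harvested power. It has the same form as the value
  in \<open>power_side_moment\<close>, and this agreement takes the place of a change of
  variables.\<close>

lemma intensity_side_moment:
  fixes K \<eta> d :: real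
  assumes "0 < K" "0 < \<eta>"
  defines "h \<equiv> \<lambda>x. normal_density d 1 x * harvested_power \<eta> K x"
  shows "set_integrable lborel {0<..} h"
    and "(LBINT x:{0<..}. h x) = \<eta> / K * (second_moment_prim d K - second_moment_prim d 0)
      + \<eta> * (d / 2 - first_moment_prim d K)"
proof -
  note FTC = set_integral_FTC_nonneg_two_pieces[of 0 K h
      "\<lambda>x. \<eta> / K * (x\<^sup>2 * normal_density d 1 x)" "\<lambda>x. \<eta> * (x * normal_density d 1 x)"
      "\<lambda>x. \<eta> / K * second_moment_prim d x" "\<lambda>x. \<eta> * first_moment_prim d x" "\<eta> * d / 2"]
  have lim: "((\<lambda>x. \<eta> * first_moment_prim d x) \<longlongrightarrow> \<eta> * d / 2) at_top"
    unfolding times_divide_eq_right[symmetric]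
    by (intro tendsto_mult_left tendsto_first_moment_prim_at_top)
  have low_prim: "((\<lambda>x. \<eta> * second_moment_prim d x / K) has_real_derivative
      \<eta> * (x\<^sup>2 * normal_density d 1 x) / K) (at x)" for x
    by (intro DERIV_cdivide DERIV_cmult DERIV_second_moment_prim)
  have "set_integrable lborel {0<..} h \<and> (LBINT x:{0<..}. h x) =
      \<eta> / K * second_moment_prim d K - \<eta> / K * second_moment_prim d 0
      + (\<eta> * d / 2 - \<eta> * first_moment_prim d K)"
    by (intro conjI; rule FTC)
      (use assms in \<open>auto simp: h_def harvested_power_def
        intro!: DERIV_cmult DERIV_first_moment_prim low_prim lim
          continuous_intros isCont_normal_density
          isCont_first_moment_prim isCont_second_moment_prim\<close>)
  then show "set_integrable lborel {0<..} h"
    and "(LBINT x:{0<..}. h x) = \<eta> / K * (second_moment_prim d K - second_moment_prim d 0)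
      + \<eta> * (d / 2 - first_moment_prim d K)"
    by (simp_all add: right_diff_distrib)
qed

lemma power_side_moment:
  assumes "0 < K" "0 < \<eta>"
  shows "set_integrable lborel {0<..} (\<lambda>p. p * power_density \<eta> K d p)"
    and "(LBINT p:{0<..}. p * power_density \<eta> K d p) =
      \<eta> / K * (second_moment_prim d K - second_moment_prim d 0)
      + \<eta> * (d / 2 - first_moment_prim d K)"
proof -
  \<comment> \<open>On the quadratic branch \<open>s p\<close> is the intensity that yields the
    power \<open>p\<close>. It sends the endpoints 0 and \<open>\<eta> * K\<close> to 0 and
    \<open>K\<close>, so the antiderivatives take the same boundary values as on the intensity
    side.\<close>
  define s where "s p = sqrt (K * p / \<eta>)" for p
  have s_c: "s (\<eta> * K) = K" and s_0: "s 0 = 0"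
    using assms by (auto simp: s_def power2_eq_square[symmetric])
  have s_sq: "(s p)\<^sup>2 = K * p / \<eta>" "0 < s p" if "0 < p" for p
    using assms that by (auto simp: s_def)
  have isCont_s: "isCont s p" for p
    unfolding s_def using assms by (intro continuous_intros) auto
  have low: "p * power_density \<eta> K d p = 1 / 2 * s p * normal_density d 1 (s p)"
    if "0 < p" "p < \<eta> * K" for p
  proof -
    have "p * sqrt (K / (\<eta> * p)) = s p"
    \<comment> \<open>Both sides are nonnegative, so comparing squares removes the roots.\<close>
    proof (rule power2_eq_imp_eq)
      show "(p * sqrt (K / (\<eta> * p)))\<^sup>2 = (s p)\<^sup>2"
        using assms that by (simp add: s_sq power_mult_distrib) (simp add: power2_eq_square)
    qed (use assms that s_sq(2)[of p] in auto)
    then show ?thesis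
      using that by (simp add: power_density_def s_def[symmetric])
  qed
  have DERIV_s: "(s has_real_derivative K / \<eta> / (2 * s p)) (at p)" if "0 < p" for p
  proof -
    have "0 < K * p / \<eta>"
      using assms that by simp
    then show ?thesis
      unfolding s_def using assms by (auto intro!: derivative_eq_intros simp: field_simps)
  qed
  have low_prim: "((\<lambda>p. \<eta> / K * second_moment_prim d (s p)) has_real_derivative
      1 / 2 * s p * normal_density d 1 (s p)) (at p)" if "0 < p" for p
    \<comment> \<open>The chain rule gives \<open>(s p)\<^sup>2\<close> times the density at
      \<open>s p\<close> times \<open>K / \<eta> / (2 * s p)\<close>; the factor
      \<open>\<eta> / K\<close> and one power of \<open>s p\<close> cancel.\<close>
    using DERIV_cmult[OF DERIV_chain2[OF DERIV_second_moment_prim DERIV_s[OF that]], of "\<eta> / K" d]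
      assms s_sq(2)[OF that] by (simp add: power2_eq_square)
  have c_pos: "0 < \<eta> * K"
    using assms by simp
  have high: "p * power_density \<eta> K d p = p / \<eta> * normal_density d 1 (p / \<eta>)"
    if "\<eta> * K < p" for p
    using that c_pos by (simp add: power_density_def)
  have high_prim: "((\<lambda>p. \<eta> * first_moment_prim d (p / \<eta>)) has_real_derivative
      p / \<eta> * normal_density d 1 (p / \<eta>)) (at p)" for p
  proof -
    have "((\<lambda>p. first_moment_prim d (p / \<eta>)) has_real_derivative
        p / \<eta> * normal_density d 1 (p / \<eta>) * (1 / \<eta>)) (at p)"
      by (intro DERIV_chain2[OF DERIV_first_moment_prim] DERIV_cdivide DERIV_ident)
    from DERIV_cmult[OF this, of \<eta>] show ?thesis
      using assms by simp
  qed
  have high_lim: "((\<lambda>p. \<eta> * first_moment_prim d (p / \<eta>)) \<longlongrightarrow> \<eta> * d / 2) at_top"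
    unfolding times_divide_eq_right[symmetric] using assms
    by (intro tendsto_mult_left filterlim_compose[OF tendsto_first_moment_prim_at_top]) real_asymp
  have cont: "isCont (\<lambda>p. 1 / 2 * s p * normal_density d 1 (s p)) p"
    "isCont (\<lambda>p. p / \<eta> * normal_density d 1 (p / \<eta>)) p"
    "isCont (\<lambda>p. \<eta> / K * second_moment_prim d (s p)) p" for p
    using assms
    by (intro continuous_intros isCont_s isCont_o2[OF _ isCont_normal_density]
        isCont_o2[OF _ isCont_second_moment_prim]; simp)+
  have nonneg: "0 \<le> 1 / 2 * s p * normal_density d 1 (s p)" if "0 < p" for p
    using s_sq(2)[OF that] by simp
  have nonneg': "0 \<le> p / \<eta> * normal_density d 1 (p / \<eta>)" if "\<eta> * K < p" for p
    using assms less_trans[OF c_pos that] by simp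
  note FTC = set_integral_FTC_nonneg_two_pieces[OF c_pos low high low_prim high_prim cont(1,2)
      nonneg nonneg' cont(3,3) DERIV_isCont[OF high_prim] high_lim]
  show "set_integrable lborel {0<..} (\<lambda>p. p * power_density \<eta> K d p)"
    by (rule FTC)
  show "(LBINT p:{0<..}. p * power_density \<eta> K d p) =
      \<eta> / K * (second_moment_prim d K - second_moment_prim d 0)
      + \<eta> * (d / 2 - first_moment_prim d K)"
    using FTC(2) assms by (simp add: s_c s_0 right_diff_distrib)
qed

theorem corollary1:
  fixes K\<^sub>c \<eta>\<^sub>c I\<^sub>d \<tau> \<nu> :: real
    and M :: "'a measure" and I :: "'a \<Rightarrow> real"
  assumes "K\<^sub>c > 0" and "\<eta>\<^sub>c > 0" and "I\<^sub>d \<ge> 0"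
    and "prob_space M"
    and "distributed M lborel I (normal_density I\<^sub>d 1)"
    and "\<tau> = 1 + erf ((I\<^sub>d - K\<^sub>c) / sqrt 2)"
    and "\<nu> = \<tau> - 1 - erf (I\<^sub>d / sqrt 2)"
  shows "integrable M (\<lambda>\<omega>. harvested_power \<eta>\<^sub>c K\<^sub>c (I \<omega>))
    \<and> set_integrable lborel {0<..} (\<lambda>p. p * power_density \<eta>\<^sub>c K\<^sub>c I\<^sub>d p)
    \<and> prob_space.expectation M (\<lambda>\<omega>. harvested_power \<eta>\<^sub>c K\<^sub>c (I \<omega>))
        = (LBINT p:{0<..}. p * power_density \<eta>\<^sub>c K\<^sub>c I\<^sub>d p)
    \<and> (LBINT p:{0<..}. p * power_density \<eta>\<^sub>c K\<^sub>c I\<^sub>d p)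
        = 1 / 2 * \<eta>\<^sub>c * I\<^sub>d * \<tau>
          - I\<^sub>d * \<eta>\<^sub>c * (exp (- ((I\<^sub>d - K\<^sub>c)\<^sup>2 / 2)) - exp (- (I\<^sub>d\<^sup>2 / 2)))
              / (sqrt (2 * pi) * K\<^sub>c)
          - 1 / 2 * (\<eta>\<^sub>c / K\<^sub>c) * (1 + I\<^sub>d\<^sup>2) * \<nu>"
proof -
  let ?h = "\<lambda>x. normal_density I\<^sub>d 1 x * harvested_power \<eta>\<^sub>c K\<^sub>c x"
  let ?V = "\<eta>\<^sub>c / K\<^sub>c * (second_moment_prim I\<^sub>d K\<^sub>c - second_moment_prim I\<^sub>d 0)
    + \<eta>\<^sub>c * (I\<^sub>d / 2 - first_moment_prim I\<^sub>d K\<^sub>c)"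
  note x_side = intensity_side_moment[OF assms(1,2), of I\<^sub>d]
  note p_side = power_side_moment[OF assms(1,2), of I\<^sub>d]
  \<comment> \<open>No power is harvested at nonpositive intensity, so the integral over the whole
    line, as used for the expectation, is the one over the positive half-line.\<close>
  have indicator_h: "(\<lambda>x. indicator {0<..} x *\<^sub>R ?h x) = ?h"
    by (auto simp: harvested_power_def indicator_def fun_eq_iff)
  have meas: "harvested_power \<eta>\<^sub>c K\<^sub>c \<in> borel_measurable lborel"
    unfolding harvested_power_def[abs_def] by measurable
  have "integrable M (\<lambda>\<omega>. harvested_power \<eta>\<^sub>c K\<^sub>c (I \<omega>))"
    using x_side(1) distributed_integrable[OF assms(5) meas]
    by (simp add: set_integrable_def indicator_h[simplified])
  moreover have "prob_space.expectation M (\<lambda>\<omega>. harvested_power \<eta>\<^sub>c K\<^sub>c (I \<omega>)) = ?V"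
    using x_side(2) distributed_integral[OF assms(5) meas]
    by (simp add: set_lebesgue_integral_def indicator_h[simplified])
  \<comment> \<open>The term \<open>K\<^sub>c\<close> times the density at \<open>K\<^sub>c\<close>
    in the second moment cancels against the density in the first moment, leaving
    \<open>I\<^sub>d * \<eta>\<^sub>c / K\<^sub>c\<close> times a difference of densities. The
    centred distribution function grows by \<open>- \<nu> / 2\<close> from 0 to
    \<open>K\<^sub>c\<close>, and 1/2 minus its value at \<open>K\<^sub>c\<close> is
    \<open>\<tau> / 2\<close>.\<close>
  moreover have "?V = 1 / 2 * \<eta>\<^sub>c * I\<^sub>d * \<tau>
      - I\<^sub>d * \<eta>\<^sub>c * (exp (- ((I\<^sub>d - K\<^sub>c)\<^sup>2 / 2)) - exp (- (I\<^sub>d\<^sup>2 / 2))) / (sqrt (2 * pi) * K\<^sub>c)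
      - 1 / 2 * (\<eta>\<^sub>c / K\<^sub>c) * (1 + I\<^sub>d\<^sup>2) * \<nu>"
  proof -
    have dens: "exp (- ((I\<^sub>d - K\<^sub>c)\<^sup>2 / 2)) = sqrt (2 * pi) * normal_density I\<^sub>d 1 K\<^sub>c"
      "exp (- (I\<^sub>d\<^sup>2 / 2)) = sqrt (2 * pi) * normal_density I\<^sub>d 1 0"
      by (simp_all add: normal_density_def power2_commute)
    have cancel: "I\<^sub>d * \<eta>\<^sub>c * (sqrt (2 * pi) * u - sqrt (2 * pi) * v) / (sqrt (2 * pi) * K\<^sub>c)
        = I\<^sub>d * \<eta>\<^sub>c * (u - v) / K\<^sub>c" for u v
      by (simp flip: right_diff_distrib)
    show ?thesis
      unfolding first_moment_prim_def second_moment_prim_def centred_normal_cdf_def dens cancel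
        assms(6,7)
      using assms(1) by (simp add: field_simps)
  qed
  ultimately show ?thesis
    using p_side by simp
qed

end
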